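(* Let $g:(0,\infty)\to\mathbb{C}$ be continuous with $g\in L^1(0,\infty)$. Then there exist two solutions $u_1$ and $u_2$ of $$u''(x)=(1+g(x))\,u(x),\qquad x\in(0,\infty),$$ such that, as $x\to\infty$, $$e^{-x}u_1(x)\to 1,\qquad e^{-x}u_1'(x)\to 1,$$ $$e^{x}u_2(x)\to 1,\qquad e^{x}u_2'(x)\to -1.$$
   Context: A solution is a twice continuously differentiable complex-valued function on $(0,\infty)$ satisfying the equation pointwise. $L^1(I)$ denotes the absolutely integrable functions on the interval $I$. *)

theory Defs
  imports "HOL-Analysis.Analysis"
begin

text \<open>A function on \<open>(0,\<infinity>)\<close> is represented by a total function on the reals; everything below depends
  only on its values on \<open>{0<..}\<close>, which is open, so that the two-sided derivatives involve no
  other values.\<close>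

abbreviation vderiv :: "(real \<Rightarrow> complex) \<Rightarrow> real \<Rightarrow> complex" where
  "vderiv u \<equiv> (\<lambda>x. vector_derivative u (at x))"

definition twice_continuously_differentiable_on ::
    "(real \<Rightarrow> complex) \<Rightarrow> real set \<Rightarrow> bool" where
  "twice_continuously_differentiable_on u S \<longleftrightarrow>
     (\<forall>x\<in>S. u differentiable (at x)) \<and>
     (\<forall>x\<in>S. vderiv u differentiable (at x)) \<and>
     continuous_on S (vderiv (vderiv u))"

definition is_solution :: "(real \<Rightarrow> complex) \<Rightarrow> (real \<Rightarrow> complex) \<Rightarrow> bool" where
  "is_solution g u \<longleftrightarrow>
     twice_continuously_differentiable_on u {0<..} \<and>
     (\<forall>x>0. vderiv (vderiv u) x = (1 + g x) * u x)"

end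

theory Submission
  imports Defs "HOL-Real_Asymp.Real_Asymp"
begin

text \<open>By variation of parameters, \<open>u = A exp x + B exp (- x)\<close> with \<open>A' = exp (- x) g u / 2\<close> and
  \<open>B' = - exp x g u / 2\<close> is a solution. Prescribing \<open>A \<rightarrow> 1\<close> at infinity and \<open>B = 0\<close> at a point \<open>a\<close>
  (growing case), or \<open>B \<rightarrow> 1\<close> and \<open>A \<rightarrow> 0\<close> at infinity (decaying case), turns this into an integral
  equation \<open>v = 1 + \<integral> k(x,s) g(s) v(s) ds\<close> for \<open>v = exp (- x) u\<close> or \<open>v = exp x u\<close>. If the integral of \<open>|g|\<close>
  over \<open>(a,\<infinity>)\<close> is small, the right-hand side is a contraction in a weighted sup norm on all of
  \<open>(0,\<infinity>)\<close> at once: to the right of \<open>a\<close> the smallness suffices, to the left of \<open>a\<close> the equation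
  is of Volterra type. The asymptotics follow by dominated convergence.\<close>

section \<open>Linear integral equations by contraction in a weighted norm\<close>

text \<open>The majorant \<open>F\<close> does not depend on \<open>x\<close>, so sequential
  continuity at each point is an instance of dominated convergence.\<close>

lemma continuous_on_lborel_integral:
  fixes K :: "real \<Rightarrow> real \<Rightarrow> complex"
  assumes meas: "\<And>x. K x \<in> borel_measurable lborel"
    and dom: "\<And>x s. norm (K x s) \<le> F s" "integrable lborel F"
    and cont: "\<And>s. continuous_on UNIV (\<lambda>x. K x s)"
  shows "continuous_on UNIV (\<lambda>x. LINT s|lborel. K x s)"
  unfolding continuous_on_sequentially comp_def
proof (intro ballI allI impI, elim conjE)
  fix X :: "nat \<Rightarrow> real" and x
  assume X: "X \<longlonglongrightarrow> x"
  show "(\<lambda>n. LINT s|lborel. K (X n) s) \<longlonglongrightarrow> (LINT s|lborel. K x s)"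
  proof (rule integral_dominated_convergence[where w=F])
    have "(\<lambda>n. K (X n) s) \<longlonglongrightarrow> K x s" for s
      using cont[of s] by (intro isCont_tendsto_compose[OF _ X]) (simp add: continuous_on_eq_continuous_at)
    then show "AE s in lborel. (\<lambda>n. K (X n) s) \<longlonglongrightarrow> K x s"
      by (rule AE_I2)
    show "AE s in lborel. norm (K (X n) s) \<le> F s" for n
      by (rule AE_I2[OF dom(1)])
  qed (rule meas dom(2))+
qed

text \<open>The unknown of the fixed-point problem is \<open>v / W\<close>, so that the contraction is with respect
  to the sup norm with weight \<open>1 / W\<close>.\<close>

lemma weighted_integral_equation:
  fixes K :: "real \<Rightarrow> real \<Rightarrow> complex" and W :: "real \<Rightarrow> real"
  assumes meas: "\<And>x. K x \<in> borel_measurable lborel"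
    and dom: "\<And>x s. norm (K x s) \<le> F s" "integrable lborel F"
    and cont: "\<And>s. continuous_on UNIV (\<lambda>x. K x s)"
    and W: "continuous_on UNIV W" "\<And>x. 1 \<le> W x" "\<And>x. W x \<le> B"
    and contr: "\<And>x. (LINT s|lborel. norm (K x s) * W s) \<le> q * W x" "q < 1"
  obtains v where "continuous_on UNIV v" "bounded (range v)"
    "\<And>x. v x = 1 + (LINT s|lborel. K x s * v s)"
proof -
  have W0: "W x > 0" "W x \<noteq> 0" "0 \<le> W x" for x using W(2)[of x] by auto
  have B0: "0 \<le> B" using W(2)[of 0] W(3)[of 0] by linarith
  have [measurable]: "K x \<in> borel_measurable borel" for x using meas[of x] by simp
  have [measurable]: "W \<in> borel_measurable borel"
    by (intro borel_measurable_continuous_onI W)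
  have [measurable]: "apply_bcontfun w \<in> borel_measurable borel" for w :: "real \<Rightarrow>\<^sub>C complex"
    by (intro borel_measurable_continuous_onI continuous_on_apply_bcontfun)
  \<comment> \<open>The unknown \<open>w\<close> ranges over the complete space of bounded
    continuous functions; \<open>I w\<close> is the kernel applied to
    \<open>v = W w\<close>.\<close>
  define I where "I w x = (LINT s|lborel. K x s * (complex_of_real (W s) * apply_bcontfun w s))"
    for w :: "real \<Rightarrow>\<^sub>C complex" and x
  have dom1: "norm (K x s * (complex_of_real (W s) * apply_bcontfun w s)) \<le> F s * (B * norm w)" for w x s
    unfolding norm_mult norm_of_real
    using W0(3)[of s] W(3)[of s] B0
    by (intro mult_mono dom(1) norm_bounded order_trans[OF norm_ge_zero dom(1)]) auto
  have domint: "integrable lborel (\<lambda>s. F s * (B * norm w))" for w :: "real \<Rightarrow>\<^sub>C complex"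
    using dom(2) by simp
  have int: "integrable lborel (\<lambda>s. K x s * (complex_of_real (W s) * apply_bcontfun w s))" for w x
  proof (rule Bochner_Integration.integrable_bound[OF domint[of w]])
    show "AE s in lborel. norm (K x s * (complex_of_real (W s) * apply_bcontfun w s)) \<le> norm (F s * (B * norm w))"
      unfolding real_norm_def by (intro AE_I2 order_trans[OF dom1 abs_ge_self])
  qed simp
  have Icont: "continuous_on UNIV (I w)" for w
    unfolding I_def
  proof (rule continuous_on_lborel_integral[OF _ dom1 domint])
    show "continuous_on UNIV (\<lambda>x. K x s * (complex_of_real (W s) * apply_bcontfun w s))" for s
      by (intro continuous_on_mult cont continuous_on_const)
  qed simp
  have intW: "integrable lborel (\<lambda>s. norm (K x s) * W s)" for x
  proof (rule Bochner_Integration.integrable_bound)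
    show "integrable lborel (\<lambda>s. F s * B)" using dom(2) by simp
    show "AE s in lborel. norm (norm (K x s) * W s) \<le> norm (F s * B)"
    proof (rule AE_I2)
      fix s
      have "norm (K x s) * W s \<le> F s * B"
        by (rule mult_mono[OF dom(1) W(3) order_trans[OF norm_ge_zero dom(1)] W0(3)])
      then show "norm (norm (K x s) * W s) \<le> norm (F s * B)"
        unfolding real_norm_def abs_of_nonneg[OF mult_nonneg_nonneg[OF norm_ge_zero W0(3)]]
        by (rule order_trans[OF _ abs_ge_self])
    qed
  qed simp
  \<comment> \<open>The hypothesis \<open>contr\<close> puts the factor \<open>W x\<close> into this
    bound; it cancels against the division by \<open>W x\<close> in \<open>T\<close>, which leaves
    the contraction constant \<open>q\<close>.\<close>
  have Idiff: "norm (I w x - I w' x) \<le> q * W x * dist w w'" for w w' x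
  proof -
    have "I w x - I w' x = (LINT s|lborel. K x s * (complex_of_real (W s) * (apply_bcontfun w s - apply_bcontfun w' s)))"
      unfolding I_def
      by (simp only: Bochner_Integration.integral_diff[OF int int, symmetric] right_diff_distrib)
    also have "norm \<dots> \<le> (LINT s|lborel. norm (K x s) * W s * dist w w')"
    proof (rule Bochner_Integration.integral_norm_bound_integral)
      show "integrable lborel (\<lambda>s. K x s * (complex_of_real (W s) * (apply_bcontfun w s - apply_bcontfun w' s)))"
        using Bochner_Integration.integrable_diff[OF int[of x w] int[of x w']]
        by (simp only: right_diff_distrib)
      show "integrable lborel (\<lambda>s. norm (K x s) * W s * dist w w')"
        using intW by simp
      fix s
      show "norm (K x s * (complex_of_real (W s) * (apply_bcontfun w s - apply_bcontfun w' s)))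
          \<le> norm (K x s) * W s * dist w w'"
        using dist_bounded[of w s w'] W0(3)[of s]
        by (simp add: norm_mult dist_norm mult.assoc mult_left_mono)
    qed
    also have "\<dots> \<le> q * W x * dist w w'"
      using contr(1)[of x] by (simp add: mult_right_mono)
    finally show ?thesis .
  qed
  define T where "T w = Bcontfun (\<lambda>x. (1 + I w x) / W x)" for w
  have T: "apply_bcontfun (T w) = (\<lambda>x. (1 + I w x) / W x)" for w
    unfolding T_def
  proof (rule Bcontfun_inverse, rule bcontfun_normI)
    show "continuous_on UNIV (\<lambda>x. (1 + I w x) / complex_of_real (W x))"
      by (intro continuous_on_divide continuous_on_add continuous_on_const continuous_on_of_real Icont W)
         (use W0(2) in simp)
    have I0: "I 0 x = 0" for x by (simp add: I_def)
    \<comment> \<open>Since \<open>1 \<le> W x\<close>, the inhomogeneous term 1 stays bounded by 1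
      after division by the weight. The absolute value of \<open>q\<close> appears because its sign
      is settled only in \<open>q0\<close>.\<close>
    show "norm ((1 + I w x) / complex_of_real (W x)) \<le> 1 + \<bar>q\<bar> * norm w" for x
    proof -
      have "norm (1 + I w x) \<le> 1 + q * W x * norm w"
        using norm_triangle_ineq[of 1 "I w x"] Idiff[of w x 0] by (simp add: I0)
      also have "\<dots> \<le> W x + \<bar>q\<bar> * W x * norm w"
        using W(2)[of x] by (intro add_mono mult_right_mono) auto
      also have "\<dots> = (1 + \<bar>q\<bar> * norm w) * W x" by (simp add: algebra_simps)
      finally show ?thesis using W0[of x] by (simp add: norm_divide divide_le_eq)
    qed
  qed
  have q0: "q \<ge> 0"
  proof -
    have "0 \<le> (LINT s|lborel. norm (K 0 s) * W s)" using W0 by (intro Bochner_Integration.integral_nonneg) auto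
    then have "0 \<le> q * W 0" using contr(1)[of 0] by linarith
    then show ?thesis using W0(1)[of 0] by (simp add: zero_le_mult_iff)
  qed
  have "dist (T w) (T w') \<le> q * dist w w'" for w w'
  proof (rule dist_bound)
    fix x
    have "(1 + I w x) / W x - (1 + I w' x) / W x = (I w x - I w' x) / W x"
      by (simp add: diff_divide_distrib[symmetric])
    then have "dist (apply_bcontfun (T w) x) (apply_bcontfun (T w') x) = norm (I w x - I w' x) / W x"
      using W0[of x] by (simp only: T dist_norm norm_divide norm_of_real abs_of_pos)
    also have "\<dots> \<le> q * dist w w'"
      using Idiff[of w x w'] W0[of x] by (simp add: field_simps)
    finally show "dist (apply_bcontfun (T w) x) (apply_bcontfun (T w') x) \<le> q * dist w w'" .
  qed
  then have "\<exists>!w. T w = w"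
    by (intro banach_fix_type[OF q0 contr(2)] allI)
  then obtain w where w: "T w = w" by (rule ex1E)
  define v where "v x = complex_of_real (W x) * apply_bcontfun w x" for x
  show thesis
  proof
    show "continuous_on UNIV v"
      unfolding v_def by (intro continuous_on_mult continuous_on_of_real W continuous_on_apply_bcontfun)
    show "bounded (range v)"
    proof (rule boundedI)
      fix y assume "y \<in> range v"
      then obtain x where "y = v x" by auto
      then have "norm y = W x * norm (apply_bcontfun w x)"
        using W0[of x] by (simp add: v_def norm_mult)
      also have "\<dots> \<le> B * norm w"
        by (rule mult_mono[OF W(3) norm_bounded B0 norm_ge_zero])
      finally show "norm y \<le> B * norm w" .
    qed
    show "v x = 1 + (LINT s|lborel. K x s * v s)" for x
    proof -
      have "apply_bcontfun w x = (1 + I w x) / W x"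
        using fun_cong[OF T[of w], of x] by (simp only: w)
      then have "v x = 1 + I w x"
        using W0[of x] by (simp add: v_def)
      then show ?thesis by (simp only: I_def v_def)
    qed
  qed
qed

section \<open>Primitives given by Lebesgue integrals over left half-lines\<close>

text \<open>The two pieces \<open>{..c}\<close> and \<open>{c..y}\<close> overlap in a null set.
  This isolates the dependence on \<open>y\<close> in a gauge integral over a compact interval, for
  which the fundamental theorem of calculus is available.\<close>

lemma set_lebesgue_integral_atMost_split:
  fixes h :: "real \<Rightarrow> 'a::euclidean_space"
  assumes "\<And>b. set_integrable lborel {..b} h" "c \<le> y"
  shows "h integrable_on {c..y}"
    "(LINT s:{..y}|lborel. h s) = (LINT s:{..c}|lborel. h s) + integral {c..y} h"
proof -
  have 1: "h integrable_on {..b}" "(LINT s:{..b}|lborel. h s) = integral {..b} h" for b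
    using set_borel_integral_eq_integral[OF assms(1)] by auto
  have "set_integrable lborel {c..y} h"
    using set_integrable_subset[OF assms(1)[of y], of "{c..y}"] by auto
  then show 2: "h integrable_on {c..y}" by (rule set_borel_integral_eq_integral)
  have "(h has_integral (integral {..c} h + integral {c..y} h)) ({..c} \<union> {c..y})"
  proof (rule has_integral_Un)
    have "{..c} \<inter> {c..y} \<subseteq> {c}" by auto
    then show "negligible ({..c} \<inter> {c..y})" by (meson negligible_sing negligible_subset)
  qed (use 1 2 in auto)
  moreover have "{..c} \<union> {c..y} = {..y}" using assms(2) by auto
  ultimately show "(LINT s:{..y}|lborel. h s) = (LINT s:{..c}|lborel. h s) + integral {c..y} h"
    by (simp add: 1 integral_unique)
qed

lemma has_vector_derivative_set_lebesgue_integral_atMost: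
  fixes h :: "real \<Rightarrow> 'a::euclidean_space"
  assumes h: "\<And>b. set_integrable lborel {..b} h" and "isCont h x"
  shows "((\<lambda>y. LINT s:{..y}|lborel. h s) has_vector_derivative h x) (at x)"
proof -
  \<comment> \<open>Any base point to the left of \<open>x\<close> would serve; changing it alters
    the primitive only by a constant.\<close>
  have "((\<lambda>u. integral {x-1..u} h) has_vector_derivative h x) (at x within ({x-1..x+1} - {}))"
    by (rule integral_has_vector_derivative_continuous_at)
       (auto intro: continuous_at_imp_continuous_at_within assms(2)
          set_lebesgue_integral_atMost_split(1)[OF h])
  then have "((\<lambda>u. integral {x-1..u} h) has_vector_derivative h x) (at x)"
    using at_within_Icc_at[of "x-1" x "x+1"] by simp
  then have "((\<lambda>u. (LINT s:{..x-1}|lborel. h s) + integral {x-1..u} h) has_vector_derivative 0 + h x) (at x)"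
    by (intro has_vector_derivative_add has_vector_derivative_const)
  then have "((\<lambda>u. (LINT s:{..x-1}|lborel. h s) + integral {x-1..u} h) has_vector_derivative h x) (at x)"
    by simp
  then show ?thesis
    by (rule has_vector_derivative_transform_within_open[where S="{x-1<..}"])
       (auto intro: set_lebesgue_integral_atMost_split(2)[OF h, symmetric])
qed

lemma continuous_on_set_lebesgue_integral_atMost:
  fixes h :: "real \<Rightarrow> 'a::euclidean_space"
  assumes h: "\<And>b. set_integrable lborel {..b} h"
  shows "continuous_on UNIV (\<lambda>y. LINT s:{..y}|lborel. h s)"
proof (rule continuous_at_imp_continuous_on, rule ballI)
  fix x :: real
  have "continuous_on {x-1..x+1} (\<lambda>y. (LINT s:{..x-1}|lborel. h s) + integral {x-1..y} h)"
    by (intro continuous_intros indefinite_integral_continuous_1 set_lebesgue_integral_atMost_split(1)[OF h]) simp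
  then have "continuous_on {x-1..x+1} (\<lambda>y. LINT s:{..y}|lborel. h s)"
    by (rule continuous_on_eq) (auto intro: set_lebesgue_integral_atMost_split(2)[OF h, symmetric])
  then show "isCont (\<lambda>y. LINT s:{..y}|lborel. h s) x"
    by (rule continuous_on_interior) simp
qed

section \<open>Variation of parameters\<close>

text \<open>The prescribed derivatives satisfy \<open>A' exp x + B' exp (- x) = 0\<close>, so the
  first derivative of \<open>u\<close> carries no term in \<open>g\<close>. On differentiating again
  the two contributions \<open>g u / 2\<close> add up instead of cancelling, and the remaining terms
  reassemble to \<open>u\<close>.\<close>

lemma is_solution_variation_of_parameters:
  fixes g A B :: "real \<Rightarrow> complex"
  defines "u \<equiv> \<lambda>x. A x * of_real (exp x) + B x * of_real (exp (- x))"
  assumes g: "continuous_on {0<..} g"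
    and A: "\<And>x. x > 0 \<Longrightarrow> (A has_vector_derivative of_real (exp (- x)) * (g x * u x / 2)) (at x)"
    and B: "\<And>x. x > 0 \<Longrightarrow> (B has_vector_derivative - (of_real (exp x) * (g x * u x / 2))) (at x)"
  shows "is_solution g u" "\<And>x. x > 0 \<Longrightarrow> vderiv u x = A x * of_real (exp x) - B x * of_real (exp (- x))"
proof -
  have e: "((\<lambda>x. complex_of_real (exp x)) has_vector_derivative of_real (exp x)) (at x)"
    "((\<lambda>x. complex_of_real (exp (- x))) has_vector_derivative - of_real (exp (- x))) (at x)" for x
    by (auto intro!: derivative_eq_intros has_vector_derivative_of_real
        simp flip: has_real_derivative_iff_has_vector_derivative of_real_minus)
  have cancel: "complex_of_real (exp (- x)) * z * of_real (exp x) = z"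
    "complex_of_real (exp x) * z * of_real (exp (- x)) = z" for x z
  proof -
    have "complex_of_real (exp x) * of_real (exp (- x)) = 1"
      by (simp flip: of_real_mult exp_add)
    then show "complex_of_real (exp (- x)) * z * of_real (exp x) = z"
      "complex_of_real (exp x) * z * of_real (exp (- x)) = z"
      by (metis mult.commute mult.left_commute mult.right_neutral)+
  qed
  have dA: "((\<lambda>x. A x * of_real (exp x)) has_vector_derivative
      A x * of_real (exp x) + g x * u x / 2) (at x)" if "x > 0" for x
    using has_vector_derivative_mult[OF A[OF that] e(1)] by (simp only: cancel)
  have dB: "((\<lambda>x. B x * of_real (exp (- x))) has_vector_derivative
      - (B x * of_real (exp (- x))) - g x * u x / 2) (at x)" if "x > 0" for x
    using has_vector_derivative_mult[OF B[OF that] e(2)]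
    by (simp only: cancel mult_minus_left mult_minus_right diff_conv_add_uminus)
  have du: "(u has_vector_derivative A x * of_real (exp x) - B x * of_real (exp (- x))) (at x)" if "x > 0" for x
    using has_vector_derivative_add[OF dA dB, OF that that] by (simp add: u_def)
  then show vu: "vderiv u x = A x * of_real (exp x) - B x * of_real (exp (- x))" if "x > 0" for x
    using that by (simp add: vector_derivative_at)
  have eq: "A x * of_real (exp x) + g x * u x / 2 - (- (B x * of_real (exp (- x))) - g x * u x / 2)
      = (1 + g x) * u x" for x
    by (simp add: u_def field_simps)
  have "((\<lambda>x. A x * of_real (exp x) - B x * of_real (exp (- x))) has_vector_derivative (1 + g x) * u x) (at x)" if "x > 0" for x
    using has_vector_derivative_diff[OF dA dB, OF that that] by (simp only: eq)
  then have ddu: "(vderiv u has_vector_derivative (1 + g x) * u x) (at x)" if "x > 0" for x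
    by (rule has_vector_derivative_transform_within_open[where S="{0<..}"]) (use vu that in auto)
  then have vvu: "vderiv (vderiv u) x = (1 + g x) * u x" if "x > 0" for x
    using that by (simp add: vector_derivative_at)
  have "continuous_on {0<..} u"
    by (intro continuous_at_imp_continuous_on ballI has_vector_derivative_continuous[OF du]) simp
  then have "continuous_on {0<..} (\<lambda>x. (1 + g x) * u x)"
    by (intro continuous_intros g)
  then have "continuous_on {0<..} (vderiv (vderiv u))"
    by (rule continuous_on_eq) (use vvu in auto)
  then show "is_solution g u"
    unfolding is_solution_def twice_continuously_differentiable_on_def
    using differentiableI_vector[OF du] differentiableI_vector[OF ddu] vvu by simp
qed

section \<open>Kernels that are of Volterra type to the left of a point\<close>

lemma set_integrable_atMost:
  fixes h :: "real \<Rightarrow> 'a::euclidean_space"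
  assumes "integrable lborel h"
  shows "set_integrable lborel {..b} h"
  using integrable_mult_indicator[OF _ assms, of "{..b}"] by (simp add: set_integrable_def)

text \<open>The weight grows at rate \<open>2 * C * norm (f s)\<close> to the left of \<open>a\<close> and equals \<open>1\<close> to the
  right of \<open>a\<close>, where smallness of the integral of \<open>f\<close> takes over. This makes the operator a
  contraction with constant \<open>1 / 2\<close>.\<close>

lemma split_kernel_integral_equation:
  fixes f :: "real \<Rightarrow> complex" and k :: "real \<Rightarrow> real \<Rightarrow> real"
  assumes f: "integrable lborel f" "\<And>s. s \<noteq> 0 \<Longrightarrow> isCont f s"
    and a: "(LINT s|lborel. norm (f s)) - (LINT s:{..a}|lborel. norm (f s)) \<le> 1 / 2"
    and meas: "\<And>x. k x \<in> borel_measurable borel"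
    and cont: "\<And>s. continuous_on UNIV (\<lambda>x. k x s)"
    and k_right: "\<And>x s. a < s \<Longrightarrow> \<bar>k x s\<bar> \<le> 1 / 2"
    and k_left: "\<And>x s. s \<le> a \<Longrightarrow> \<bar>k x s\<bar> \<le> C" "\<And>x s. s \<le> x \<Longrightarrow> s \<le> a \<Longrightarrow> k x s = 0"
  shows "\<exists>v. continuous_on UNIV v \<and> bounded (range v) \<and>
    (\<forall>x. v x = 1 + (LINT s|lborel. k x s * f s * v s))"
proof -
  \<comment> \<open>\<open>D\<close> bounds the kernel on both sides of \<open>a\<close>, because it
    dominates \<open>C\<close> and 1/2, and it is positive, as division by \<open>2 * D\<close>
    requires.\<close>
  define D where "D = max C 1"
  have D: "D > 0" "C \<le> D" "1/2 \<le> D" by (auto simp: D_def)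
  define S where "S y = (LINT s:{..y}|lborel. norm (f s))" for y
  define W where "W x = exp (2 * D * (S a - S (min x a)))" for x
  have [measurable]: "f \<in> borel_measurable borel" using f(1) by simp
  have N: "integrable lborel (\<lambda>s. norm (f s))" using f(1) by simp
  have Nset: "set_integrable lborel {..b} (\<lambda>s. norm (f s))" for b
    by (rule set_integrable_atMost[OF N])
  have Nset': "integrable lborel (\<lambda>s. indicator {..b} s * norm (f s))" for b
    using Nset[of b] by (simp add: set_integrable_def)
  have Scont: "continuous_on UNIV S"
    unfolding S_def by (rule continuous_on_set_lebesgue_integral_atMost[OF Nset])
  have Smono: "S x \<le> S y" if "x \<le> y" for x y
    unfolding S_def set_lebesgue_integral_def real_scaleR_def using that
    by (intro Bochner_Integration.integral_mono Nset') (auto simp: indicator_def)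
  have S0: "0 \<le> S x" for x
    unfolding S_def set_lebesgue_integral_def by (intro Bochner_Integration.integral_nonneg) auto
  have Wcont: "continuous_on UNIV W"
    unfolding W_def
    by (intro continuous_intros continuous_on_compose2[OF Scont]) auto
  have W1: "1 \<le> W x" for x
    unfolding W_def using Smono[of "min x a" a] D by simp
  have W0: "0 \<le> W x" for x
    by (simp add: W_def)
  have WB: "W x \<le> exp (2 * D * S a)" for x
    unfolding W_def using S0[of "min x a"] D by simp
  have W_right: "W x = 1" if "a \<le> x" for x
    using that by (simp add: W_def min_def)
  have [measurable]: "W \<in> borel_measurable borel"
    by (intro borel_measurable_continuous_onI Wcont)
  have intW: "integrable lborel (\<lambda>s. indicator {x..a} s * (norm (f s) * W s))" for x
  proof (rule Bochner_Integration.integrable_bound)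
    show "integrable lborel (\<lambda>s. norm (f s) * exp (2 * D * S a))" using N by simp
    show "AE s in lborel. norm (indicator {x..a} s * (norm (f s) * W s))
        \<le> norm (norm (f s) * exp (2 * D * S a))"
      using W0 by (intro AE_I2) (simp add: abs_mult indicator_def mult_left_mono[OF WB])
  qed simp
  \<comment> \<open>To the left of \<open>a\<close> the derivative of \<open>W\<close> is
    \<open>- 2 * D * norm (f s) * W s\<close>. Hence \<open>- W / (2 * D)\<close> is a primitive of
    the integrand, and \<open>W a = 1\<close>.\<close>
  have weight: "(LINT s|lborel. indicator {x..a} s * (norm (f s) * W s)) = (W x - 1) / (2 * D)" for x
  proof (cases "x \<le> a")
    case True
    have "((\<lambda>s. norm (f s) * W s) has_integral
        (- exp (2 * D * (S a - S a)) / (2 * D) - - exp (2 * D * (S a - S x)) / (2 * D))) {x..a}"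
    \<comment> \<open>\<open>f\<close> may jump at 0, so \<open>S\<close> is differentiated away
      from 0 only; its continuity there makes this one exceptional point harmless.\<close>
    proof (rule fundamental_theorem_of_calculus_interior_strong[where S="{0}"])
      fix s assume s: "s \<in> {x<..<a} - {0}"
      have "(S has_vector_derivative norm (f s)) (at s)"
        unfolding S_def using s f(2)[of s]
        by (intro has_vector_derivative_set_lebesgue_integral_atMost Nset) auto
      then have "(S has_real_derivative norm (f s)) (at s)"
        by (simp add: has_real_derivative_iff_has_vector_derivative)
      then have "((\<lambda>y. - exp (2 * D * (S a - S y)) / (2 * D)) has_real_derivative norm (f s) * W s) (at s)"
        using s D by (auto intro!: derivative_eq_intros simp: W_def)
      then show "((\<lambda>y. - exp (2 * D * (S a - S y)) / (2 * D)) has_vector_derivative norm (f s) * W s) (at s)"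
        by (simp add: has_real_derivative_iff_has_vector_derivative)
    next
      show "continuous_on {x..a} (\<lambda>y. - exp (2 * D * (S a - S y)) / (2 * D))"
        using D by (intro continuous_intros continuous_on_subset[OF Scont]) auto
    qed (use True in auto)
    moreover have "(LINT s:{x..a}|lborel. norm (f s) * W s) = integral {x..a} (\<lambda>s. norm (f s) * W s)"
      by (rule set_borel_integral_eq_integral) (use intW in \<open>simp add: set_integrable_def\<close>)
    ultimately show ?thesis
      using True D by (simp add: set_lebesgue_integral_def integral_unique W_def diff_divide_distrib)
  qed (simp add: W_right)
  have [measurable]: "k x \<in> borel_measurable borel" for x by (rule meas)
  have k_bound: "\<bar>k x s\<bar> \<le> D" for x s
    using k_right[of s x] k_left(1)[of s x] D by (cases "s \<le> a") auto
  show ?thesis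
  proof (rule weighted_integral_equation[where K = "\<lambda>x s. complex_of_real (k x s) * f s" and W = W
        and F = "\<lambda>s. D * norm (f s)" and B = "exp (2 * D * S a)" and q = "1 / 2"])
    show "norm (complex_of_real (k x s) * f s) \<le> D * norm (f s)" for x s
      using k_bound by (auto simp: norm_mult intro: mult_right_mono)
    show "(LINT s|lborel. norm (complex_of_real (k x s) * f s) * W s) \<le> 1 / 2 * W x" for x
    proof -
      \<comment> \<open>Beyond \<open>a\<close> the weight is 1 and the kernel is at most 1/2, which
        gives half of the tail of \<open>norm (f s)\<close>. Up to \<open>a\<close> the kernel lives
        on \<open>x < s\<close> and is at most \<open>D\<close>, which gives the integral computed
        in \<open>weight\<close>.\<close>
      have "(LINT s|lborel. norm (complex_of_real (k x s) * f s) * W s)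
        \<le> (LINT s|lborel. (norm (f s) - indicator {..a} s * norm (f s)) / 2
              + D * (indicator {x..a} s * (norm (f s) * W s)))"
      proof (rule Bochner_Integration.integral_mono)
        show "integrable lborel (\<lambda>s. norm (complex_of_real (k x s) * f s) * W s)"
        proof (rule Bochner_Integration.integrable_bound)
          show "integrable lborel (\<lambda>s. D * norm (f s) * exp (2 * D * S a))" using N by simp
          show "AE s in lborel. norm (norm (complex_of_real (k x s) * f s) * W s)
              \<le> norm (D * norm (f s) * exp (2 * D * S a))"
          proof (rule AE_I2)
            fix s
            have "\<bar>k x s\<bar> * norm (f s) * W s \<le> D * norm (f s) * exp (2 * D * S a)"
              using D by (intro mult_mono k_bound WB W0) auto
            then show "norm (norm (complex_of_real (k x s) * f s) * W s)
                \<le> norm (D * norm (f s) * exp (2 * D * S a))"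
              using W0[of s] D(1) by (simp add: norm_mult abs_mult)
          qed
        qed simp
        fix s
        consider "a < s" | "s \<le> x" "s \<le> a" | "x < s" "s \<le> a" by linarith
        then show "norm (complex_of_real (k x s) * f s) * W s
            \<le> (norm (f s) - indicator {..a} s * norm (f s)) / 2
              + D * (indicator {x..a} s * (norm (f s) * W s))"
        proof cases
          case 1
          then show ?thesis
            using mult_right_mono[OF k_right[OF 1, of x], of "norm (f s)"]
            by (simp add: W_right norm_mult)
        next
          case 2
          then show ?thesis
            using k_left(2)[OF 2] D W1[of s] by (auto simp: norm_mult)
        next
          case 3
          then show ?thesis
            using mult_right_mono[OF k_bound[of x s], of "norm (f s) * W s"] W1[of s]
            by (simp add: norm_mult mult.assoc)
        qed
      qed (use N Nset' intW in auto)
      \<comment> \<open>The tail term is at most 1/4 and is absorbed by the -1/2 in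
        \<open>(W x - 1) / 2\<close>, so the total is at most \<open>W x / 2\<close>.\<close>
      also have "\<dots> = ((LINT s|lborel. norm (f s)) - S a) / 2 + (W x - 1) / 2"
        using N Nset' intW D by (simp add: weight S_def set_lebesgue_integral_def)
      also have "\<dots> \<le> (1 / 2) / 2 + (W x - 1) / 2"
        using a by (intro add_right_mono divide_right_mono) (simp_all only: S_def)
      finally show ?thesis by (simp add: field_simps)
    qed
  next
    show "continuous_on UNIV (\<lambda>x. complex_of_real (k x s) * f s)" for s
      by (intro continuous_on_mult continuous_on_of_real continuous_on_const cont)
    show "integrable lborel (\<lambda>s. D * norm (f s))" using N by simp
    show "(\<lambda>s. complex_of_real (k x s) * f s) \<in> borel_measurable lborel" for x
      by measurable
    show ?thesis if "continuous_on UNIV v" "bounded (range v)"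
      "\<And>x. v x = 1 + (LINT s|lborel. complex_of_real (k x s) * f s * v s)" for v
      using that by blast
  qed (rule Wcont W1 WB | simp)+
qed

section \<open>Limits and integrability with exponential factors\<close>

text \<open>Dominated convergence with majorant \<open>norm (h s)\<close>. It serves for the kernels
  \<open>exp (- (2 * (x - s)))\<close> on \<open>s \<le> x\<close> and
  \<open>exp (2 * (x - s))\<close> on \<open>s > x\<close>, which produce the vanishing second
  component of each solution.\<close>

lemma tendsto_lborel_integral_vanishing_kernel:
  fixes h :: "real \<Rightarrow> complex" and m :: "real \<Rightarrow> real \<Rightarrow> real"
  assumes h: "integrable lborel h"
    and meas: "\<And>x. m x \<in> borel_measurable borel"
    and bound: "\<And>x s. \<bar>m x s\<bar> \<le> 1"
    and lim: "\<And>s. ((\<lambda>x. m x s) \<longlongrightarrow> 0) at_top"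
  shows "((\<lambda>x. LINT s|lborel. m x s * h s) \<longlongrightarrow> 0) at_top"
proof -
  have [measurable]: "h \<in> borel_measurable borel" "m x \<in> borel_measurable borel" for x
    using h meas by auto
  have "((\<lambda>x. LINT s|lborel. m x s * h s) \<longlongrightarrow> (LINT s|(lborel::real measure). 0)) at_top"
  proof (rule integral_dominated_convergence_at_top[where w="\<lambda>s. norm (h s)"])
    show "AE s in lborel. ((\<lambda>x. m x s * h s) \<longlongrightarrow> 0) at_top"
    proof (rule AE_I2)
      fix s
      have "((\<lambda>x. m x s * h s) \<longlongrightarrow> of_real 0 * h s) at_top"
        by (intro tendsto_intros lim)
      then show "((\<lambda>x. m x s * h s) \<longlongrightarrow> 0) at_top" by simp
    qed
    show "\<forall>\<^sub>F x in at_top. AE s in lborel. norm (m x s * h s) \<le> norm (h s)"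
      by (intro always_eventually allI AE_I2)
         (simp add: norm_mult mult_left_le_one_le bound)
  qed (use h in auto)
  then show ?thesis by simp
qed

lemma integrable_mult_bounded_continuous:
  fixes f v :: "real \<Rightarrow> complex"
  assumes "integrable lborel f" "continuous_on UNIV v" "bounded (range v)"
  shows "integrable lborel (\<lambda>s. f s * v s)"
proof -
  obtain M where M: "\<And>s. norm (v s) \<le> M"
    using assms(3) by (auto simp: bounded_iff)
  have [measurable]: "f \<in> borel_measurable borel" "v \<in> borel_measurable borel"
    using assms(1) borel_measurable_continuous_onI[OF assms(2)] by auto
  show ?thesis
  proof (rule Bochner_Integration.integrable_bound)
    show "integrable lborel (\<lambda>s. norm (f s) * M)" using assms(1) by simp
    show "AE s in lborel. norm (f s * v s) \<le> norm (norm (f s) * M)"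
    proof (rule AE_I2)
      fix s
      have "0 \<le> M" using M[of s] norm_ge_zero order_trans by blast
      then show "norm (f s * v s) \<le> norm (norm (f s) * M)"
        using mult_left_mono[OF M[of s], of "norm (f s)"] by (simp add: norm_mult)
    qed
  qed simp
qed

text \<open>On the part of \<open>{..b}\<close> where \<open>h\<close> can be nonzero,
  \<open>s\<close> lies in a bounded interval, so the exponential factor is bounded for either sign
  of \<open>c\<close>.\<close>

lemma set_integrable_exp_mult:
  fixes h :: "real \<Rightarrow> complex"
  assumes h: "integrable lborel h" "\<And>s. s \<le> 0 \<Longrightarrow> h s = 0"
  shows "set_integrable lborel {..b} (\<lambda>s. complex_of_real (exp (c * s)) * h s)"
proof -
  have [measurable]: "h \<in> borel_measurable borel" using h(1) by simp
  show ?thesis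
    unfolding set_integrable_def
  proof (rule Bochner_Integration.integrable_bound)
  show "integrable lborel (\<lambda>s. exp (\<bar>c\<bar> * \<bar>b\<bar>) * norm (h s))" using h(1) by simp
  show "AE s in lborel. norm (indicator {..b} s *\<^sub>R (complex_of_real (exp (c * s)) * h s))
      \<le> norm (exp (\<bar>c\<bar> * \<bar>b\<bar>) * norm (h s))"
  proof (rule AE_I2)
    fix s
    show "norm (indicator {..b} s *\<^sub>R (complex_of_real (exp (c * s)) * h s))
      \<le> norm (exp (\<bar>c\<bar> * \<bar>b\<bar>) * norm (h s))"
    proof (cases "0 < s \<and> s \<le> b")
      case True
      then have "\<bar>c * s\<bar> \<le> \<bar>c\<bar> * \<bar>b\<bar>" by (simp add: abs_mult mult_left_mono)
      then have "exp (c * s) \<le> exp (\<bar>c\<bar> * \<bar>b\<bar>)" by simp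
      then show ?thesis using True by (simp add: norm_mult mult_right_mono)
    next
      case False
      then show ?thesis using h(2)[of s] by (cases "s \<le> 0") auto
    qed
  qed
  qed measurable
qed

section \<open>Construction of the two solutions\<close>

text \<open>Extending \<open>g\<close> by zero to \<open>f\<close> lets all integrals run over the
  whole line, at the price of a possible jump at 0. In each case a fixed point \<open>v\<close>
  defines \<open>A\<close> and \<open>B\<close> as integrals of \<open>f v\<close> with exponential
  factors; the integral equation then identifies \<open>v\<close> with the rescaled
  \<open>u\<close>, so that \<open>A\<close> and \<open>B\<close> satisfy the equations of variation
  of parameters.\<close>

lemma exponential_solutions:
  fixes f g :: "real \<Rightarrow> complex"
  assumes g: "continuous_on {0<..} g"
    and f: "integrable lborel f" "\<And>x. 0 < x \<Longrightarrow> f x = g x" "\<And>x. x \<le> 0 \<Longrightarrow> f x = 0"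
    and a: "(LINT s|lborel. norm (f s)) - (LINT s:{..a}|lborel. norm (f s)) \<le> 1 / 2"
  shows exponentially_growing_solution: "\<exists>u. is_solution g u \<and>
      ((\<lambda>x. complex_of_real (exp (- x)) * u x) \<longlongrightarrow> 1) at_top \<and>
      ((\<lambda>x. complex_of_real (exp (- x)) * vderiv u x) \<longlongrightarrow> 1) at_top" (is ?growing)
    and exponentially_decaying_solution: "\<exists>u. is_solution g u \<and>
      ((\<lambda>x. complex_of_real (exp x) * u x) \<longlongrightarrow> 1) at_top \<and>
      ((\<lambda>x. complex_of_real (exp x) * vderiv u x) \<longlongrightarrow> - 1) at_top" (is ?decaying)
proof -
  have f_cont: "isCont f s" if "s \<noteq> 0" for s
  proof (cases "0 < s")
    case True
    have "isCont g s" using g True by (simp add: continuous_on_eq_continuous_at)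
    moreover have "\<forall>\<^sub>F x in nhds s. f x = g x"
      using True f(2) eventually_nhds_in_open[of "{0<..}" s] by (auto elim: eventually_mono)
    ultimately show ?thesis using isCont_cong by blast
  next
    case False
    then have "\<forall>\<^sub>F x in nhds s. f x = 0"
      using that f(3) eventually_nhds_in_open[of "{..<0}" s] by (auto elim: eventually_mono)
    then show ?thesis using isCont_cong[of f "\<lambda>_. 0" s] by simp
  qed
  have e2: "complex_of_real (exp (2 * x)) = of_real (exp x) * of_real (exp x)"
    "complex_of_real (exp (- (2 * x))) = of_real (exp (- x)) * of_real (exp (- x))"
    "complex_of_real (exp (- x)) * of_real (exp x) = 1"
    "complex_of_real (exp x) * of_real (exp (- x)) = 1" for x
    by (simp_all flip: of_real_mult exp_add)
  have e2': "complex_of_real (exp (- x)) * (of_real (exp x) * z) = z"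
    "complex_of_real (exp x) * (of_real (exp (- x)) * z) = z" for x z
    using e2(3,4) by (simp_all flip: mult.assoc)
  \<comment> \<open>For \<open>u = c exp x + d exp (- x)\<close> with derivative
    \<open>c exp x - d exp (- x)\<close>, the first two identities rescale \<open>u\<close> and its
    derivative in the growing case, the last two in the decaying case.\<close>
  have scale:
    "complex_of_real (exp (- x)) * (c * of_real (exp x) + d * of_real (exp (- x)))
      = c + of_real (exp (- (2 * x))) * d"
    "complex_of_real (exp (- x)) * (c * of_real (exp x) - d * of_real (exp (- x)))
      = c - of_real (exp (- (2 * x))) * d"
    "complex_of_real (exp x) * (c * of_real (exp x) + d * of_real (exp (- x)))
      = of_real (exp (2 * x)) * c + d"
    "complex_of_real (exp x) * (c * of_real (exp x) - d * of_real (exp (- x)))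
      = of_real (exp (2 * x)) * c - d" for c d x
    unfolding e2(1,2) by - (use e2(4)[of x] in algebra)+
  \<comment> \<open>The exponent \<open>c = 0\<close> gives the derivative of \<open>S\<close>
    below; \<open>c = 2\<close> and \<open>c = - 2\<close> give that of \<open>E\<close> in the
    growing and the decaying case.\<close>
  have hd: "((\<lambda>y. LINT s:{..y}|lborel. complex_of_real (exp (c * s)) * (f s * v s))
        has_vector_derivative complex_of_real (exp (c * x)) * (g x * v x)) (at x)"
    and hi: "integrable lborel (\<lambda>s. f s * v s)"
    and he: "\<And>b. set_integrable lborel {..b} (\<lambda>s. complex_of_real (exp (c * s)) * (f s * v s))"
    if v: "continuous_on UNIV v" "bounded (range v)" and x: "0 < x" for v c x
  proof -
    show hi: "integrable lborel (\<lambda>s. f s * v s)"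
      by (rule integrable_mult_bounded_continuous[OF f(1) v])
    then show he: "set_integrable lborel {..b} (\<lambda>s. complex_of_real (exp (c * s)) * (f s * v s))" for b
      by (rule set_integrable_exp_mult) (simp add: f(3))
    have "isCont v x" using v(1) by (simp add: continuous_on_eq_continuous_at)
    then have "isCont (\<lambda>s. complex_of_real (exp (c * s)) * (f s * v s)) x"
      using f_cont[of x] x by (intro continuous_intros) auto
    from has_vector_derivative_set_lebesgue_integral_atMost[OF he this]
    show "((\<lambda>y. LINT s:{..y}|lborel. complex_of_real (exp (c * s)) * (f s * v s))
        has_vector_derivative complex_of_real (exp (c * x)) * (g x * v x)) (at x)"
      using f(2)[OF x] by simp
  qed

  \<comment> \<open>The growing solution\<close>
  show ?growing
  proof -
    \<comment> \<open>Only \<open>x > 0\<close> matters; \<open>max 0 x\<close> keeps the kernel bounded for negative \<open>x\<close>.\<close>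
    define k where "k x s = (if s \<le> a then (exp (2 * max 0 (s - max 0 x)) - 1) / 2
      else - exp (- (2 * max 0 (x - s))) / 2)" for x s :: real
    \<comment> \<open>For \<open>x > 0\<close> the kernel collects the integrals in
      \<open>A + exp (- (2 * x)) * B\<close>. Starting \<open>B\<close> at \<open>a\<close> makes
      the contributions with \<open>s \<le> x\<close> and \<open>s \<le> a\<close> cancel, while
      beyond \<open>a\<close> only decaying exponentials or the constant 1/2 remain.\<close>
    have "\<exists>v. continuous_on UNIV v \<and> bounded (range v) \<and>
      (\<forall>x. v x = 1 + (LINT s|lborel. k x s * f s * v s))"
    proof (rule split_kernel_integral_equation[OF f(1) f_cont a])
      show "k x \<in> borel_measurable borel" for x unfolding k_def by measurable
      show "continuous_on UNIV (\<lambda>x. k x s)" for s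
        unfolding k_def by (cases "s \<le> a") (auto intro!: continuous_intros)
      show "\<bar>k x s\<bar> \<le> 1 / 2" if "a < s" for x s
        using that by (simp add: k_def)
      \<comment> \<open>The growing exponential occurs for \<open>s \<le> a\<close> only, and its
        exponent is at most \<open>2 * a\<close> or 0. The maximum allows for a negative
        \<open>a\<close>.\<close>
      show "\<bar>k x s\<bar> \<le> exp (2 * max 0 a)" if "s \<le> a" for x s
      proof -
        have "exp (2 * max 0 (s - max 0 x)) \<le> exp (2 * max 0 a)" using that by auto
        moreover have "1 \<le> exp (2 * max 0 (s - max 0 x))" by simp
        moreover have "\<bar>(p - 1) / 2\<bar> \<le> q" if "1 \<le> p" "p \<le> q" for p q :: real
          using that by (simp add: abs_if)
        ultimately have "\<bar>(exp (2 * max 0 (s - max 0 x)) - 1) / 2\<bar> \<le> exp (2 * max 0 a)"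
          by blast
        with that show ?thesis by (simp only: k_def if_True)
      qed
      show "k x s = 0" if "s \<le> x" "s \<le> a" for x s
        using that by (auto simp: k_def)
    qed
    then obtain v where v: "continuous_on UNIV v" "bounded (range v)"
      "\<And>x. v x = 1 + (LINT s|lborel. k x s * f s * v s)"
      by blast
    define h where "h s = f s * v s" for s
    define S where "S y = (LINT s:{..y}|lborel. h s)" for y
    define E where "E y = (LINT s:{..y}|lborel. complex_of_real (exp (2 * s)) * h s)" for y
    define I where "I = (LINT s|lborel. h s)"
    define A where "A x = 1 - (I - S x) / 2" for x
    define B where "B x = (E a - E x) / 2" for x
    define u where "u x = A x * of_real (exp x) + B x * of_real (exp (- x))" for x
    note hint = hi[OF v(1,2) zero_less_one, folded h_def]
    have Sint: "set_integrable lborel {..b} h" for b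
      by (rule set_integrable_atMost[OF hint])
    note Eint = he[OF v(1,2) zero_less_one, of _ 2, folded h_def]
    \<comment> \<open>Writing the case distinctions of the kernel as indicators turns the integral
      into a combination of \<open>S\<close>, \<open>I\<close> and \<open>E\<close>. Positivity of
      \<open>x\<close> is what removes \<open>max 0 x\<close> from the kernel.\<close>
    have v_eq: "v x = A x + of_real (exp (- (2 * x))) * B x" if "x > 0" for x
    proof -
      have "complex_of_real (k x s) * h s = (indicator {..x} s *\<^sub>R h s - h s) / 2
        + of_real (exp (- (2 * x))) / 2 * (indicator {..a} s *\<^sub>R (of_real (exp (2 * s)) * h s)
          - indicator {..x} s *\<^sub>R (of_real (exp (2 * s)) * h s))" for s
      proof -
        have *: "k x s = (indicator {..x} s - 1) / 2
            + exp (- (2 * x)) / 2 * (indicator {..a} s * exp (2 * s) - indicator {..x} s * exp (2 * s))"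
          using that by (auto simp: k_def indicator_def max_def exp_minus field_simps exp_diff)
        show ?thesis
          unfolding * by (simp add: scaleR_conv_of_real field_simps)
      qed
      then have "(LINT s|lborel. k x s * h s)
        = (S x - I) / 2 + of_real (exp (- (2 * x))) / 2 * (E a - E x)"
        using hint Sint Eint
        by (simp add: S_def I_def E_def set_lebesgue_integral_def set_integrable_def)
      then show ?thesis
        using v(3)[of x] by (simp add: A_def B_def h_def mult.assoc diff_divide_distrib)
    qed
    have u_eq: "u x = of_real (exp x) * v x" if "x > 0" for x
      unfolding u_def v_eq[OF that] e2(2) using e2(4)[of x] by algebra
    have dS: "(S has_vector_derivative g x * v x) (at x)" if "x > 0" for x
      using hd[OF v(1,2) that, of 0] by (simp add: S_def[abs_def] h_def[abs_def])
    have dE: "(E has_vector_derivative of_real (exp (2 * x)) * (g x * v x)) (at x)" if "x > 0" for x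
      using hd[OF v(1,2) that, of 2] by (simp add: E_def[abs_def] h_def[abs_def])
    have dA: "(A has_vector_derivative of_real (exp (- x)) * (g x * u x / 2)) (at x)" if "x > 0" for x
    proof -
      have "(A has_vector_derivative 0 - (0 - g x * v x) / 2) (at x)"
        unfolding A_def[abs_def] by (intro derivative_intros dS that)
      then show ?thesis by (simp add: u_eq[OF that] e2' mult.left_commute)
    qed
    have dB: "(B has_vector_derivative - (of_real (exp x) * (g x * u x / 2))) (at x)" if "x > 0" for x
    proof -
      have "(B has_vector_derivative (0 - of_real (exp (2 * x)) * (g x * v x)) / 2) (at x)"
        unfolding B_def[abs_def] by (intro derivative_intros dE that)
      then show ?thesis by (simp add: u_eq[OF that] e2 mult.left_commute mult.assoc)
    qed
    note sol = is_solution_variation_of_parameters[OF g dA[unfolded u_def] dB[unfolded u_def], folded u_def]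
    have lim_S: "(S \<longlongrightarrow> I) at_top"
      unfolding S_def[abs_def] I_def set_lebesgue_integral_def
      by (rule tendsto_integral_at_top[OF _ hint]) simp
    have lim_A: "(A \<longlongrightarrow> 1) at_top"
    proof -
      have "(A \<longlongrightarrow> 1 - (I - I) / 2) at_top"
        unfolding A_def[abs_def] by (intro tendsto_intros lim_S) simp
      then show ?thesis by simp
    qed
    have exp_lim: "((\<lambda>x. exp (- (2 * x))) \<longlongrightarrow> (0::real)) at_top"
      by real_asymp
    \<comment> \<open>\<open>E\<close> itself may grow. Taking \<open>exp (- (2 * x))\<close> inside
      the integral gives a kernel bounded by 1 that tends to 0 for each fixed
      \<open>s\<close>.\<close>
    have "((\<lambda>x. LINT s|lborel. complex_of_real (indicator {..x} s * exp (- (2 * (x - s)))) * h s) \<longlongrightarrow> 0) at_top"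
    proof (rule tendsto_lborel_integral_vanishing_kernel[OF hint])
      show "(\<lambda>s. indicator {..x} s * exp (- (2 * (x - s)))) \<in> borel_measurable borel" for x :: real
        by measurable
      show "\<bar>indicator {..x} s * exp (- (2 * (x - s)))\<bar> \<le> 1" for x s :: real
        by (simp add: indicator_def)
      show "((\<lambda>x. indicator {..x} s * exp (- (2 * (x - s)))) \<longlongrightarrow> 0) at_top" for s :: real
      proof (rule Lim_transform_eventually)
        show "((\<lambda>x. exp (- (2 * (x - s)))) \<longlongrightarrow> 0) at_top" by real_asymp
        show "\<forall>\<^sub>F x in at_top. exp (- (2 * (x - s))) = indicator {..x} s * exp (- (2 * (x - s)))"
          using eventually_ge_at_top[of s] by eventually_elim simp
      qed
    qed
    also have "(\<lambda>x. LINT s|lborel. complex_of_real (indicator {..x} s * exp (- (2 * (x - s)))) * h s)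
      = (\<lambda>x. of_real (exp (- (2 * x))) * E x)"
    proof
      fix x
      have "complex_of_real (indicator {..x} s * exp (- (2 * (x - s)))) * h s
          = of_real (exp (- (2 * x))) * (indicator {..x} s *\<^sub>R (of_real (exp (2 * s)) * h s))" for s
        by (simp add: exp_diff exp_minus field_simps scaleR_conv_of_real)
      then show "(LINT s|lborel. complex_of_real (indicator {..x} s * exp (- (2 * (x - s)))) * h s)
          = of_real (exp (- (2 * x))) * E x"
        by (simp only: E_def set_lebesgue_integral_def integral_mult_right_zero)
    qed
    finally have lim_E: "((\<lambda>x. complex_of_real (exp (- (2 * x))) * E x) \<longlongrightarrow> 0) at_top" .
    have lim_B: "((\<lambda>x. complex_of_real (exp (- (2 * x))) * B x) \<longlongrightarrow> 0) at_top"
    proof -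
      have "((\<lambda>x. (complex_of_real (exp (- (2 * x))) * E a - complex_of_real (exp (- (2 * x))) * E x) / 2)
          \<longlongrightarrow> (of_real 0 * E a - 0) / 2) at_top"
        by (intro tendsto_intros lim_E exp_lim) simp
      then show ?thesis by (simp add: B_def algebra_simps diff_divide_distrib)
    qed
    show ?growing
    proof (intro exI conjI)
      show "is_solution g u" by (rule sol(1))
      have "((\<lambda>x. A x + of_real (exp (- (2 * x))) * B x) \<longlongrightarrow> 1 + 0) at_top"
        by (intro tendsto_add lim_A lim_B)
      then show "((\<lambda>x. complex_of_real (exp (- x)) * u x) \<longlongrightarrow> 1) at_top"
        by (simp only: u_def scale add_0_right)
      have "((\<lambda>x. A x - of_real (exp (- (2 * x))) * B x) \<longlongrightarrow> 1 - 0) at_top"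
        by (intro tendsto_diff lim_A lim_B)
      moreover have "\<forall>\<^sub>F x in at_top. A x - of_real (exp (- (2 * x))) * B x
          = complex_of_real (exp (- x)) * vderiv u x"
        using eventually_gt_at_top[of 0]
        by eventually_elim (simp only: sol(2) scale)
      ultimately show "((\<lambda>x. complex_of_real (exp (- x)) * vderiv u x) \<longlongrightarrow> 1) at_top"
        using Lim_transform_eventually by fastforce
    qed
  qed

  \<comment> \<open>The decaying solution\<close>
  show ?decaying
  proof -
    \<comment> \<open>For \<open>v = exp x u\<close>, integrating \<open>A\<close> and
      \<open>B\<close> from infinity gives the kernel \<open>(1 - exp (- (2 * (s - x)))) / 2\<close>
      on \<open>s > x\<close> and 0 elsewhere; \<open>max 0\<close> merges the two cases. It is
      bounded by 1/2 for every real \<open>x\<close>, so \<open>x\<close> itself needs no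
      truncation.\<close>
    define k where "k x s = (1 - exp (- (2 * max 0 (s - x)))) / 2" for x s :: real
    have k_bound: "\<bar>k x s\<bar> \<le> 1 / 2" for x s
    proof -
      have "\<bar>(1 - p) / 2\<bar> \<le> 1 / 2" if "0 < p" "p \<le> 1" for p :: real
        using that by simp
      then show ?thesis by (simp add: k_def)
    qed
    have "\<exists>v. continuous_on UNIV v \<and> bounded (range v) \<and>
      (\<forall>x. v x = 1 + (LINT s|lborel. k x s * f s * v s))"
    proof (rule split_kernel_integral_equation[OF f(1) f_cont a])
      show "k x \<in> borel_measurable borel" for x unfolding k_def by measurable
      show "continuous_on UNIV (\<lambda>x. k x s)" for s
        unfolding k_def by (intro continuous_intros) simp
      show "\<bar>k x s\<bar> \<le> 1 / 2" for x s by (rule k_bound)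
      show "\<bar>k x s\<bar> \<le> 1 / 2" for x s by (rule k_bound)
      show "k x s = 0" if "s \<le> x" for x s
        using that by (simp add: k_def)
    qed
    then obtain v where v: "continuous_on UNIV v" "bounded (range v)"
      "\<And>x. v x = 1 + (LINT s|lborel. k x s * f s * v s)"
      by blast
    define h where "h s = f s * v s" for s
    define S where "S y = (LINT s:{..y}|lborel. h s)" for y
    define E where "E y = (LINT s:{..y}|lborel. complex_of_real (exp (- 2 * s)) * h s)" for y
    define I where "I = (LINT s|lborel. h s)"
    define J where "J = (LINT s|lborel. complex_of_real (exp (- 2 * s)) * h s)"
    define A where "A x = (E x - J) / 2" for x
    define B where "B x = 1 + (I - S x) / 2" for x
    define u where "u x = A x * of_real (exp x) + B x * of_real (exp (- x))" for x
    note hint = hi[OF v(1,2) zero_less_one, folded h_def]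
    have [measurable]: "h \<in> borel_measurable borel" using hint by simp
    have Sint: "set_integrable lborel {..b} h" for b
      by (rule set_integrable_atMost[OF hint])
    note Eint = he[OF v(1,2) zero_less_one, of _ "- 2", folded h_def]
    \<comment> \<open>\<open>h\<close> vanishes for \<open>s \<le> 0\<close>, and
      \<open>exp (- 2 * s)\<close> is at most 1 on the rest.\<close>
    have Jint: "integrable lborel (\<lambda>s. complex_of_real (exp (- 2 * s)) * h s)"
    proof (rule Bochner_Integration.integrable_bound[OF hint])
      show "AE s in lborel. norm (complex_of_real (exp (- 2 * s)) * h s) \<le> norm (h s)"
      proof (rule AE_I2)
        fix s
        show "norm (complex_of_real (exp (- 2 * s)) * h s) \<le> norm (h s)"
        proof (cases "s \<le> 0")
          case True
          then show ?thesis by (simp add: h_def f(3))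
        next
          case False
          then show ?thesis by (simp add: norm_mult mult_left_le_one_le)
        qed
      qed
    qed simp
    have v_eq: "v x = of_real (exp (2 * x)) * A x + B x" for x
    proof -
      have "complex_of_real (k x s) * h s = (h s - indicator {..x} s *\<^sub>R h s) / 2
        + of_real (exp (2 * x)) / 2 * (indicator {..x} s *\<^sub>R (of_real (exp (- 2 * s)) * h s)
          - of_real (exp (- 2 * s)) * h s)" for s
      proof -
        have *: "k x s = (1 - indicator {..x} s) / 2
            + exp (2 * x) / 2 * (indicator {..x} s * exp (- 2 * s) - exp (- 2 * s))"
          by (auto simp: k_def indicator_def max_def exp_minus field_simps exp_diff)
        show ?thesis
          unfolding * by (simp add: scaleR_conv_of_real field_simps)
      qed
      then have "(LINT s|lborel. k x s * h s)
        = (I - S x) / 2 + of_real (exp (2 * x)) / 2 * (E x - J)"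
        using hint Sint Eint Jint
        by (simp add: S_def I_def E_def J_def set_lebesgue_integral_def set_integrable_def)
      then show ?thesis
        using v(3)[of x] by (simp add: A_def B_def h_def mult.assoc diff_divide_distrib)
    qed
    have u_eq: "u x = of_real (exp (- x)) * v x" for x
      unfolding u_def v_eq e2(1) using e2(4)[of x] by algebra
    have dS: "(S has_vector_derivative g x * v x) (at x)" if "x > 0" for x
      using hd[OF v(1,2) that, of 0] by (simp add: S_def[abs_def] h_def[abs_def])
    have dE: "(E has_vector_derivative of_real (exp (- (2 * x))) * (g x * v x)) (at x)" if "x > 0" for x
      using hd[OF v(1,2) that, of "- 2"] by (simp add: E_def[abs_def] h_def[abs_def])
    have dA: "(A has_vector_derivative of_real (exp (- x)) * (g x * u x / 2)) (at x)" if "x > 0" for x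
    proof -
      have "(A has_vector_derivative (of_real (exp (- (2 * x))) * (g x * v x) - 0) / 2) (at x)"
        unfolding A_def[abs_def] by (intro derivative_intros dE that)
      then show ?thesis by (simp add: u_eq e2 mult.left_commute mult.assoc)
    qed
    have dB: "(B has_vector_derivative - (of_real (exp x) * (g x * u x / 2))) (at x)" if "x > 0" for x
    proof -
      have "(B has_vector_derivative 0 + (0 - g x * v x) / 2) (at x)"
        unfolding B_def[abs_def] by (intro derivative_intros dS that)
      then show ?thesis by (simp add: u_eq e2' mult.left_commute)
    qed
    note sol = is_solution_variation_of_parameters[OF g dA[unfolded u_def] dB[unfolded u_def], folded u_def]
    have lim_S: "(S \<longlongrightarrow> I) at_top"
      unfolding S_def[abs_def] I_def set_lebesgue_integral_def
      by (rule tendsto_integral_at_top[OF _ hint]) simp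
    have lim_B: "(B \<longlongrightarrow> 1) at_top"
    proof -
      have "(B \<longlongrightarrow> 1 + (I - I) / 2) at_top"
        unfolding B_def[abs_def] by (intro tendsto_intros lim_S) simp
      then show ?thesis by simp
    qed
    \<comment> \<open>This integral is \<open>- 2\<close> times the component
      \<open>exp (2 * x) * A x\<close>. The exponential is at most 1 on \<open>s > x\<close>, and
      for fixed \<open>s\<close> the indicator is 0 once \<open>x \<ge> s\<close>.\<close>
    have "((\<lambda>x. LINT s|lborel. complex_of_real (indicator {x<..} s * exp (2 * (x - s))) * h s) \<longlongrightarrow> 0) at_top"
    proof (rule tendsto_lborel_integral_vanishing_kernel[OF hint])
      show "(\<lambda>s. indicator {x<..} s * exp (2 * (x - s))) \<in> borel_measurable borel" for x :: real
        by measurable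
      show "\<bar>indicator {x<..} s * exp (2 * (x - s))\<bar> \<le> 1" for x s :: real
        by (simp add: indicator_def)
      show "((\<lambda>x. indicator {x<..} s * exp (2 * (x - s))) \<longlongrightarrow> 0) at_top" for s :: real
        by (rule tendsto_eventually, rule eventually_mono[OF eventually_ge_at_top[of s]]) simp
    qed
    moreover have "(LINT s|lborel. complex_of_real (indicator {x<..} s * exp (2 * (x - s))) * h s)
        = - 2 * (of_real (exp (2 * x)) * A x)" for x
    proof -
      have "complex_of_real (indicator {x<..} s * exp (2 * (x - s))) * h s
          = of_real (exp (2 * x)) * (of_real (exp (- 2 * s)) * h s
            - indicator {..x} s *\<^sub>R (of_real (exp (- 2 * s)) * h s))" for s
        by (simp add: exp_diff exp_minus field_simps indicator_def)
      then have "(LINT s|lborel. complex_of_real (indicator {x<..} s * exp (2 * (x - s))) * h s)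
          = of_real (exp (2 * x)) * (J - E x)"
        using Jint Eint
        by (simp only: E_def J_def set_lebesgue_integral_def set_integrable_def
            integral_mult_right_zero Bochner_Integration.integral_diff)
      also have "\<dots> = - 2 * (of_real (exp (2 * x)) * A x)"
        by (simp add: A_def algebra_simps)
      finally show ?thesis .
    qed
    ultimately have "((\<lambda>x. - 2 * (complex_of_real (exp (2 * x)) * A x)) \<longlongrightarrow> 0) at_top"
      by simp
    from tendsto_mult_left[OF this, of "- 1 / 2"]
    have lim_A: "((\<lambda>x. complex_of_real (exp (2 * x)) * A x) \<longlongrightarrow> 0) at_top"
      by simp
    show ?decaying
    proof (intro exI conjI)
      show "is_solution g u" by (rule sol(1))
      have "((\<lambda>x. of_real (exp (2 * x)) * A x + B x) \<longlongrightarrow> 0 + 1) at_top"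
        by (intro tendsto_add lim_A lim_B)
      then show "((\<lambda>x. complex_of_real (exp x) * u x) \<longlongrightarrow> 1) at_top"
        by (simp only: u_def scale add_0_left)
      have "((\<lambda>x. of_real (exp (2 * x)) * A x - B x) \<longlongrightarrow> 0 - 1) at_top"
        by (intro tendsto_diff lim_A lim_B)
      moreover have "\<forall>\<^sub>F x in at_top. of_real (exp (2 * x)) * A x - B x
          = complex_of_real (exp x) * vderiv u x"
        using eventually_gt_at_top[of 0]
        by eventually_elim (simp only: sol(2) scale)
      ultimately show "((\<lambda>x. complex_of_real (exp x) * vderiv u x) \<longlongrightarrow> - 1) at_top"
        using Lim_transform_eventually by fastforce
    qed
  qed
qed

section \<open>Extension by zero and choice of a point with small tail\<close>

theorem proposition2p1:
  fixes g :: "real \<Rightarrow> complex"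
  assumes "continuous_on {0<..} g"
    and "g absolutely_integrable_on {0<..}"
  shows "\<exists>u1 u2. is_solution g u1 \<and> is_solution g u2 \<and>
    ((\<lambda>x. complex_of_real (exp (- x)) * u1 x) \<longlongrightarrow> 1) at_top \<and>
    ((\<lambda>x. complex_of_real (exp (- x)) * vderiv u1 x) \<longlongrightarrow> 1) at_top \<and>
    ((\<lambda>x. complex_of_real (exp x) * u2 x) \<longlongrightarrow> 1) at_top \<and>
    ((\<lambda>x. complex_of_real (exp x) * vderiv u2 x) \<longlongrightarrow> - 1) at_top"
proof -
  define f where "f = (\<lambda>x. indicator {0<..} x *\<^sub>R g x)"
  \<comment> \<open>Absolute integrability refers to the completed measure; Borel measurability of
    \<open>f\<close>, obtained from continuity on an open set, brings it down to
    \<open>lborel\<close>.\<close>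
  have "f \<in> borel_measurable borel"
    unfolding f_def by (rule borel_measurable_continuous_on_indicator[OF _ assms(1)]) simp
  then have f: "integrable lborel f"
    using assms(2) integrable_completion[of f lborel]
    by (simp add: f_def set_integrable_def)
  define N where "N = (LINT s|lborel. norm (f s))"
  \<comment> \<open>The mass of \<open>norm (f s)\<close> on \<open>{..y}\<close> exhausts the total
    \<open>N\<close>, so some \<open>a\<close> leaves less than 1/2 beyond it, the smallness that
    the contraction estimate uses.\<close>
  have "((\<lambda>y. LINT s:{..y}|lborel. norm (f s)) \<longlongrightarrow> N) at_top"
    unfolding N_def set_lebesgue_integral_def
    using f by (intro tendsto_integral_at_top) auto
  then have "\<forall>\<^sub>F y in at_top. N - 1 / 2 < (LINT s:{..y}|lborel. norm (f s))"
    by (rule order_tendstoD) simp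
  then obtain a where "N - 1 / 2 < (LINT s:{..a}|lborel. norm (f s))"
    using eventually_happens by fastforce
  then have a: "(LINT s|lborel. norm (f s)) - (LINT s:{..a}|lborel. norm (f s)) \<le> 1 / 2"
    unfolding N_def by linarith
  have f_eq: "f x = g x" if "0 < x" for x using that by (simp add: f_def)
  have f_0: "f x = 0" if "x \<le> 0" for x using that by (simp add: f_def)
  show ?thesis
    using exponentially_growing_solution[OF assms(1) f f_eq f_0 a]
      exponentially_decaying_solution[OF assms(1) f f_eq f_0 a]
    by blast
qed

end
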